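(* The left overlap division $\mathcal O$ on the monomials of $R\langle x_1,\dots,x_n\rangle$ is continuous.
   Context: Monomials are words in the noncommuting variables $x_1,\dots,x_n$. An involutive division is a rule $I$ assigning to every finite set $U$ of monomials and every $u\in U$ a set $\mathcal M^L_I(u,U)\subseteq\{x_1,\dots,x_n\}$ of left multiplicative variables and a set $\mathcal M^R_I(u,U)\subseteq\{x_1,\dots,x_n\}$ of right multiplicative variables. For $u\in U$ and a factorisation $w=v_1uv_2$, $u$ is an involutive divisor of $w$ at this factorisation if (thin divisors) the last letter of $v_1$ (if $v_1\ne1$) is in $\mathcal M^L_I(u,U)$ and the first letter of $v_2$ (if $v_2\neq1$) is in $\mathcal M^R_I(u,U)$. Left overlap division $\mathcal O$. Let $U$ be a finite set of monomials. All variables are left multiplicative for all elements of $U$. All variables are right multiplicative except those made right nonmultiplicative by the following rules: (a) whenever $u_j\in U$ occurs as a subword of a different $u_i\in U$ at a position that is not the suffix position, the letter of $u_i$ immediately to the right of that occurrence is right nonmultiplicative for $u_j$; (b) whenever $u_i,u_j\in U$ (possibly equal) and $1\le k<\min(\deg u_i,\deg u_j)$ are such that the prefix of $u_i$ of length $k$ equals the suffix of $u_j$ of length $k$, the $(k+1)$-st letter of $u_i$ is right nonmultiplicative for $u_j$. Continuity. Let $w$ be a monomial, $U$ a finite set of monomials, and $(u_1,\dots,u_k)$ a sequence in $U$ with factorisations $w=\ell_iu_ir_i$. Suppose for each $1\le i<k$ exactly one of the following holds: (a) $\ell_i\neq1$, its last letter $x$ is not in $\mathcal M^L_I(u_i,U)$,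 and $u_{i+1}$ involutively divides $xu_i$; (b) $r_i\ne1$, its first letter $x$ is not in $\mathcal M^R_I(u_i,U)$, and $u_{i+1}$ involutively divides $u_ix$; where the occurrence of $u_{i+1}$ in $w$ given by $(\ell_{i+1},r_{i+1})$ is the one induced by its occurrence (as involutive divisor) in the prolongation $xu_i$, resp. $u_ix$, located in $w$. $I$ is continuous if for all such data the pairs $(\ell_i,r_i)$ are pairwise distinct. *)

theory Defs
  imports Main
begin

text \<open>Monomials are words over a type of letters (the variables), the monomial 1 is \<open>[]\<close>,
  and the product of monomials is concatenation.\<close>

type_synonym 'a monomial = "'a list"

text \<open>The values of the two fields at \<open>u\<close> and \<open>U\<close> are only relevant for finite \<open>U\<close> and
  \<open>u \<in> U\<close>.\<close>

record 'a involutive_division =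
  left_mult :: "'a monomial \<Rightarrow> 'a monomial set \<Rightarrow> 'a set"
  right_mult :: "'a monomial \<Rightarrow> 'a monomial set \<Rightarrow> 'a set"

text \<open>Thin divisors: \<open>u\<close> is an involutive divisor of \<open>v1 @ u @ v2\<close> at this very factorisation.\<close>

definition inv_divisor_at ::
  "'a involutive_division \<Rightarrow> 'a monomial set \<Rightarrow> 'a monomial \<Rightarrow> 'a monomial \<Rightarrow> 'a monomial \<Rightarrow> bool"
  where
  "inv_divisor_at I U v1 u v2 \<longleftrightarrow>
     u \<in> U \<and>
     (v1 \<noteq> [] \<longrightarrow> last v1 \<in> left_mult I u U) \<and>
     (v2 \<noteq> [] \<longrightarrow> hd v2 \<in> right_mult I u U)"

text \<open>A step from the occurrence \<open>w = l @ u @ r\<close> to the occurrence \<open>w = l' @ u' @ r'\<close> through the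
  left prolongation of \<open>u\<close> by the last letter of \<open>l\<close>. The last two conjuncts say that the new
  occurrence is the one induced by the factorisation \<open>v1 @ u' @ v2\<close> of the prolongation.\<close>

definition left_step ::
  "'a involutive_division \<Rightarrow> 'a monomial set \<Rightarrow>
   'a monomial \<Rightarrow> 'a monomial \<Rightarrow> 'a monomial \<Rightarrow>
   'a monomial \<Rightarrow> 'a monomial \<Rightarrow> 'a monomial \<Rightarrow> bool"
  where
  "left_step I U l u r l' u' r' \<longleftrightarrow>
     l \<noteq> [] \<and> last l \<notin> left_mult I u U \<and>
     (\<exists>v1 v2. last l # u = v1 @ u' @ v2 \<and> inv_divisor_at I U v1 u' v2 \<and>
        l' = butlast l @ v1 \<and> r' = v2 @ r)"

definition right_step ::
  "'a involutive_division \<Rightarrow> 'a monomial set \<Rightarrow>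
   'a monomial \<Rightarrow> 'a monomial \<Rightarrow> 'a monomial \<Rightarrow>
   'a monomial \<Rightarrow> 'a monomial \<Rightarrow> 'a monomial \<Rightarrow> bool"
  where
  "right_step I U l u r l' u' r' \<longleftrightarrow>
     r \<noteq> [] \<and> hd r \<notin> right_mult I u U \<and>
     (\<exists>v1 v2. u @ [hd r] = v1 @ u' @ v2 \<and> inv_divisor_at I U v1 u' v2 \<and>
        l' = l @ v1 \<and> r' = v2 @ tl r)"

text \<open>The sequences are indexed from 1 to \<open>k\<close>; the inequality of the two truth values of the
  steps expresses that exactly one of them holds.\<close>

definition continuous_division :: "'a involutive_division \<Rightarrow> bool" where
  "continuous_division I \<longleftrightarrow>
     (\<forall>(U :: 'a monomial set) (w :: 'a monomial) (k :: nat)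
        (u :: nat \<Rightarrow> 'a monomial) (l :: nat \<Rightarrow> 'a monomial) (r :: nat \<Rightarrow> 'a monomial).
        finite U \<longrightarrow>
        (\<forall>i\<in>{1..k}. u i \<in> U \<and> w = l i @ u i @ r i) \<longrightarrow>
        (\<forall>i\<in>{1..<k}.
           left_step I U (l i) (u i) (r i) (l (i+1)) (u (i+1)) (r (i+1)) \<noteq>
           right_step I U (l i) (u i) (r i) (l (i+1)) (u (i+1)) (r (i+1))) \<longrightarrow>
        inj_on (\<lambda>i. (l i, r i)) {1..k})"

text \<open>The two sets below collect the letters made right nonmultiplicative for \<open>u\<close> by an
  occurrence of \<open>u\<close> in another element \<open>v\<close> of \<open>U\<close> that is not at the suffix position, and by a
  prefix of some \<open>v \<in> U\<close> (possibly \<open>v = u\<close>) that is a suffix of \<open>u\<close>. As list indices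
  start at 0, \<open>v ! m\<close> is the letter number \<open>m + 1\<close> of \<open>v\<close>.\<close>

definition subword_nonmult :: "'a monomial \<Rightarrow> 'a monomial set \<Rightarrow> 'a set" where
  "subword_nonmult u U = {x. \<exists>v\<in>U. v \<noteq> u \<and> (\<exists>p s. v = p @ u @ [x] @ s)}"

definition overlap_nonmult :: "'a monomial \<Rightarrow> 'a monomial set \<Rightarrow> 'a set" where
  "overlap_nonmult u U =
     {x. \<exists>v\<in>U. \<exists>m. 1 \<le> m \<and> m < min (length v) (length u) \<and>
        take m v = drop (length u - m) u \<and> x = v ! m}"

definition left_overlap_division :: "'a involutive_division" where
  "left_overlap_division =
     \<lparr>left_mult = (\<lambda>u U. UNIV),
      right_mult = (\<lambda>u U. UNIV - (subword_nonmult u U \<union> overlap_nonmult u U))\<rparr>"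

end

theory Submission
  imports Defs
begin

text \<open>All steps of the left overlap division are right steps, because every letter is left
  multiplicative. The right nonmultiplicative letters of a word \<open>u\<close> are also nonmultiplicative for
  every suffix of \<open>u\<close> in \<open>U\<close>, and a proper subword of \<open>u\<close> not at the suffix position is excluded by
  rule (a). Hence an involutive divisor of \<open>u x\<close>, with \<open>x\<close> nonmultiplicative for \<open>u\<close>, must be a
  suffix of \<open>u x\<close>, so the right cofactor strictly shrinks in every step.\<close>

text \<open>An overlap shorter than \<open>u\<close> is also an overlap for \<open>u\<close>, so
  rule (b) applies. Otherwise the overlap contains all of \<open>u\<close>, so that \<open>x\<close>
  directly follows an occurrence of \<open>u\<close> in \<open>v\<close> and rule (a)
  applies.\<close>

lemma overlap_nonmult_append_subset:
  "overlap_nonmult (p @ u) U \<subseteq> subword_nonmult u U \<union> overlap_nonmult u U"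
proof
  fix x assume "x \<in> overlap_nonmult (p @ u) U"
  then obtain v m where v: "v \<in> U" and m: "1 \<le> m" "m < length v" "m < length (p @ u)"
    and eq: "take m v = drop (length (p @ u) - m) (p @ u)" and x: "x = v ! m"
    unfolding overlap_nonmult_def by auto
  show "x \<in> subword_nonmult u U \<union> overlap_nonmult u U"
  proof (cases "m < length u")
    case True
    with eq have "take m v = drop (length u - m) u" by simp
    with True v m x show ?thesis unfolding overlap_nonmult_def by auto
  next
    case False
    \<comment> \<open>\<open>q\<close> is the part of the overlap that lies in
      \<open>p\<close>.\<close>
    define q where "q = drop (length (p @ u) - m) p"
    have "take m v = q @ u" using eq False by (simp add: q_def)
    moreover have "v = take m v @ [x] @ drop (Suc m) v"
      using m(2) x by (simp add: id_take_nth_drop)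
    ultimately have "v = q @ u @ [x] @ drop (Suc m) v" by simp
    moreover from this have "v \<noteq> u" by (auto dest: arg_cong[where f = length])
    ultimately show ?thesis using v unfolding subword_nonmult_def by blast
  qed
qed

lemma subword_nonmult_append_subset:
  "subword_nonmult (p @ u) U \<subseteq> subword_nonmult u U"
proof
  fix x assume "x \<in> subword_nonmult (p @ u) U"
  then obtain v q s where v: "v \<in> U" "v = (q @ p) @ u @ [x] @ s"
    unfolding subword_nonmult_def by auto
  moreover from v(2) have "v \<noteq> u" by (auto dest: arg_cong[where f = length])
  ultimately show "x \<in> subword_nonmult u U" unfolding subword_nonmult_def by blast
qed

lemma right_prolongation_divisor_is_suffix:
  assumes u: "u \<in> U" and x: "x \<notin> right_mult left_overlap_division u U"
    and eq: "u @ [x] = v1 @ u' @ v2"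
    and dvd: "inv_divisor_at left_overlap_division U v1 u' v2"
  shows "v2 = []"
proof (cases v2 rule: rev_cases)
  case (snoc v y)
  with eq have uv: "u = v1 @ u' @ v" and y: "y = x" by auto
  have hd: "hd v2 \<notin> subword_nonmult u' U \<union> overlap_nonmult u' U"
    using dvd snoc by (auto simp: inv_divisor_at_def left_overlap_division_def)
  show ?thesis
  proof (cases v)
    case Nil
    \<comment> \<open>Here \<open>u'\<close> is a suffix of \<open>u\<close> and thus inherits the
      nonmultiplicative letter \<open>x\<close>.\<close>
    with snoc y have "hd v2 = x" by simp
    moreover have "x \<in> subword_nonmult (v1 @ u') U \<union> overlap_nonmult (v1 @ u') U"
      using x uv Nil by (auto simp: left_overlap_division_def)
    ultimately show ?thesis
      using hd overlap_nonmult_append_subset[of v1 u' U]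
        subword_nonmult_append_subset[of v1 u' U] by blast
  next
    case (Cons z s)
    \<comment> \<open>Here \<open>u\<close> itself is the word that makes \<open>z\<close>
      nonmultiplicative for \<open>u'\<close> by rule (a).\<close>
    with uv have "u = v1 @ u' @ [z] @ s" and "u \<noteq> u'"
      by (auto dest: arg_cong[where f = length])
    with u have "z \<in> subword_nonmult u' U" unfolding subword_nonmult_def by blast
    with hd snoc Cons show ?thesis by simp
  qed
qed simp

text \<open>As \<open>v2\<close> is empty, \<open>r'\<close> is just \<open>tl r\<close>.\<close>

lemma right_step_length_less:
  assumes "u \<in> U" and "right_step left_overlap_division U l u r l' u' r'"
  shows "length r' < length r"
  using assms right_prolongation_divisor_is_suffix[of u U "hd r"]
  unfolding right_step_def by (cases r) fastforce+

lemma not_left_step_left_overlap_division: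
  "\<not> left_step left_overlap_division U l u r l' u' r'"
  by (simp add: left_step_def left_overlap_division_def)

theorem proposition5p5p14:
  shows "continuous_division (left_overlap_division :: ('a::finite) involutive_division)"
  unfolding continuous_division_def
proof (intro allI impI)
  fix U :: "'a monomial set" and w :: "'a monomial" and k :: nat
    and u l r :: "nat \<Rightarrow> 'a monomial"
  assume occ: "\<forall>i\<in>{1..k}. u i \<in> U \<and> w = l i @ u i @ r i"
    and steps: "\<forall>i\<in>{1..<k}.
      left_step left_overlap_division U (l i) (u i) (r i) (l (i+1)) (u (i+1)) (r (i+1)) \<noteq>
      right_step left_overlap_division U (l i) (u i) (r i) (l (i+1)) (u (i+1)) (r (i+1))"
  \<comment> \<open>Without left steps, the inequality of truth values forces a right step.\<close>
  have shrink: "length (r (Suc i)) < length (r i)" if "1 \<le> i" "i < k" for i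
    using occ steps that right_step_length_less[of "u i" U]
    by (force simp: not_left_step_left_overlap_division)
  have decr: "length (r j) < length (r i)" if "1 \<le> i" "i < j" "j \<le> k" for i j
    using that(2,1,3)
  \<comment> \<open>\<open>i\<close> descends from \<open>j\<close>, with \<open>j\<close>
    fixed.\<close>
  proof (induction rule: strict_inc_induct)
    case (base i)
    then show ?case using shrink[of i] by simp
  next
    case (step i)
    then show ?case using shrink[of i] by simp
  qed
  show "inj_on (\<lambda>i. (l i, r i)) {1..k}"
  proof (rule linorder_inj_onI')
    fix i j assume "i \<in> {1..k}" "j \<in> {1..k}" "i < j"
    then show "(l i, r i) \<noteq> (l j, r j)" using decr[of i j] by auto
  qed
qed

end
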